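(* Let $S$ be a regular epigroup and let $a,b\in S$. Then $a\sim b$ if and only if there exists a pair of mutually inverse elements $u,v\in S$ such that $ae_a=u\cdot be_b\cdot v$ and $be_b=v\cdot ae_a\cdot u$.
   Context: Let $S$ be a semigroup. A group element is an element belonging to some subgroup of $S$ (a subsemigroup which is a group under the operation of $S$); $a\in S$ is group-bound if $a^t$ is a group element for some $t\geq 1$; $S$ is an epigroup if all its elements are group-bound. $S$ is regular if for each $s\in S$ there is $s'\in S$ with $s=ss's$. For a group-bound element $a$, $e_a$ denotes the identity element of the group $H_{a^t}$ (the $\mathcal{H}$-class of $a^t$ for Green's relation $\mathcal{H}$), where $t\ge 1$ is such that $H_{a^t}$ is a group; this does not depend on the choice of $t$. Elements $u,v\in S$ are mutually inverse if $u=uvu$ and $v=vuv$. Write $a\sim_p b$ if there exist $x,y\in S$ with $a=xy$ and $b=yx$; the relation $\sim$ (conjugacy) is the transitive closure of $\sim_p$ on $S$. *)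

theory Defs
  imports "HOL-Algebra.Group"
begin

definition regular_element :: "'a::semigroup_mult \<Rightarrow> bool" where
  "regular_element s \<longleftrightarrow> (\<exists>s'. s = s * s' * s)"

(* A semigroup has no unit, so the power a^t is only meaningful for t >= 1;
   the value at t = 0 is a dummy (it is a) and is never used. *)
definition sg_power :: "'a::semigroup_mult \<Rightarrow> nat \<Rightarrow> 'a" where
  "sg_power a t = ((\<lambda>x. x * a) ^^ (t - 1)) a"

definition group_with_identity :: "'a::semigroup_mult set \<Rightarrow> 'a \<Rightarrow> bool" where
  "group_with_identity G e \<longleftrightarrow> group \<lparr>carrier = G, monoid.mult = (*), one = e\<rparr>"

definition group_element :: "'a::semigroup_mult \<Rightarrow> bool" where
  "group_element a \<longleftrightarrow> (\<exists>G e. group_with_identity G e \<and> a \<in> G)"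

definition group_bound :: "'a::semigroup_mult \<Rightarrow> bool" where
  "group_bound a \<longleftrightarrow> (\<exists>t\<ge>1. group_element (sg_power a t))"

(* Green's relations: equality of the principal left (right) ideals S^1 a (a S^1),
   where S^1 is S with a unit adjoined if necessary. *)
definition green_L :: "'a::semigroup_mult \<Rightarrow> 'a \<Rightarrow> bool" where
  "green_L a b \<longleftrightarrow> insert a (range (\<lambda>x. x * a)) = insert b (range (\<lambda>x. x * b))"

definition green_R :: "'a::semigroup_mult \<Rightarrow> 'a \<Rightarrow> bool" where
  "green_R a b \<longleftrightarrow> insert a (range (\<lambda>x. a * x)) = insert b (range (\<lambda>x. b * x))"

definition green_H :: "'a::semigroup_mult \<Rightarrow> 'a \<Rightarrow> bool" where
  "green_H a b \<longleftrightarrow> green_L a b \<and> green_R a b"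

definition H_class :: "'a::semigroup_mult \<Rightarrow> 'a set" where
  "H_class a = {b. green_H a b}"

(* The element e_a; only meaningful for group-bound a, for which the e below
   exists and does not depend on the exponent t. *)
definition epi_idem :: "'a::semigroup_mult \<Rightarrow> 'a" where
  "epi_idem a = (THE e. \<exists>t\<ge>1. group_with_identity (H_class (sg_power a t)) e)"

definition mutually_inverse :: "'a::semigroup_mult \<Rightarrow> 'a \<Rightarrow> bool" where
  "mutually_inverse u v \<longleftrightarrow> u = u * v * u \<and> v = v * u * v"

definition primarily_conjugate :: "'a::semigroup_mult \<Rightarrow> 'a \<Rightarrow> bool" where
  "primarily_conjugate a b \<longleftrightarrow> (\<exists>x y. a = x * y \<and> b = y * x)"

definition conjugate :: "'a::semigroup_mult \<Rightarrow> 'a \<Rightarrow> bool" where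
  "conjugate = primarily_conjugate\<^sup>+\<^sup>+"

end

theory Submission
  imports Defs
begin

text \<open>
  The element \<open>a e\<^sub>a\<close> lives in a maximal subgroup, and \<open>e\<^sub>a = a c\<close> where \<open>c\<close> is the inverse of
  \<open>a e\<^sub>a\<close> in that subgroup. This \<open>c\<close> is the Drazin inverse of \<open>a\<close>: it commutes with \<open>a\<close>,
  satisfies \<open>c a c = c\<close>, and \<open>a c\<close> fixes some power of \<open>a\<close>. Since \<open>a c\<close> is determined by these
  equations (\<open>drazin_idempotent_unique\<close>), everything about \<open>e\<^sub>a\<close> becomes equational once
  \<open>epi_idem_drazin\<close> identifies it with \<open>a c\<close>.

  The key computation is Cline's formula: if \<open>a = x y\<close> and \<open>b = y x\<close>, then \<open>y c c x\<close> is the Drazin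
  inverse of \<open>b\<close>, so \<open>e\<^sub>b = y c x\<close>. Hence \<open>u = e\<^sub>a x\<close> and \<open>v = y c\<close> are mutually inverse with
  \<open>u v = e\<^sub>a\<close> and \<open>v u = e\<^sub>b\<close>, and they carry \<open>a e\<^sub>a\<close> and \<open>b e\<^sub>b\<close> to each other. Keeping the two
  idempotents in the statement is what makes this relation transitive, so it holds along
  every chain of primary conjugations; this is the forward direction.

  Conversely, the two equations of the theorem exhibit \<open>a e\<^sub>a\<close> and \<open>b e\<^sub>b\<close> as primarily conjugate,
  so it remains to see that \<open>a\<close> is conjugate to \<open>a e\<^sub>a\<close>. Here regularity enters: if
  \<open>a = a a' a\<close>, then \<open>a = (a a') a\<close> is primarily conjugate to \<open>b = a a a'\<close>, for which a power with
  an exponent smaller by one is already fixed by \<open>e\<^sub>b\<close>. As \<open>a e\<^sub>a\<close> and \<open>b e\<^sub>b\<close> are primarily conjugate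
  as well, induction on the exponent reduces to the case \<open>a = a e\<^sub>a\<close>.
\<close>

section \<open>Powers and maximal subgroups\<close>

lemma sg_power_Suc_0 [simp]: "sg_power a (Suc 0) = a"
  by (simp add: sg_power_def)

lemma sg_power_Suc_Suc: "sg_power a (Suc (Suc n)) = sg_power a (Suc n) * a"
  by (simp add: sg_power_def)

lemma sg_power_commute:
  assumes "b * a = a * b"
  shows "b * sg_power a (Suc n) = sg_power a (Suc n) * b"
proof (induction n)
  case 0
  show ?case using assms by simp
next
  case (Suc n)
  then show ?case using assms by (metis sg_power_Suc_Suc mult.assoc)
qed

text \<open>For idempotent \<open>e\<close>, the units of the local monoid \<open>e S e\<close>: the largest subgroup with identity \<open>e\<close>, given
  without reference to Green's relations.\<close>

definition local_units :: "'a::semigroup_mult \<Rightarrow> 'a set" where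
  "local_units e = {y. e * y = y \<and> y * e = y \<and>
     (\<exists>z. e * z = z \<and> z * e = z \<and> y * z = e \<and> z * y = e)}"

lemma group_local_units:
  assumes "e * e = (e::'a::semigroup_mult)"
  shows "group_with_identity (local_units e) e"
  unfolding group_with_identity_def
proof (rule groupI; simp)
  fix x y :: 'a
  assume "x \<in> local_units e" "y \<in> local_units e"
  then obtain x' y' where
    x: "e * x = x" "x * e = x" "e * x' = x'" "x' * e = x'" "x * x' = e" "x' * x = e" and
    y: "e * y = y" "y * e = y" "e * y' = y'" "y' * e = y'" "y * y' = e" "y' * y = e"
    unfolding local_units_def by blast
  have "(x * y) * (y' * x') = e" "(y' * x') * (x * y) = e"
    using x y by (metis mult.assoc)+
  moreover have "e * (x * y) = x * y" "(x * y) * e = x * y"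
    "e * (y' * x') = y' * x'" "(y' * x') * e = y' * x'"
    using x y by (metis mult.assoc)+
  ultimately show "x * y \<in> local_units e"
    unfolding local_units_def by blast
next
  show "e \<in> local_units e" using assms by (auto simp: local_units_def)
next
  fix x y z :: 'a
  show "x * y * z = x * (y * z)" by (rule mult.assoc)
next
  fix x assume "x \<in> local_units e"
  then show "e * x = x" by (simp add: local_units_def)
next
  fix x assume "x \<in> local_units e"
  then show "\<exists>y\<in>local_units e. y * x = e" unfolding local_units_def by blast
qed

lemma group_with_identity_subset_local_units:
  assumes "group_with_identity G e"
  shows "G \<subseteq> local_units e" and "e * e = e"
proof -
  interpret group "\<lparr>carrier = G, monoid.mult = (*), one = e\<rparr>"
    using assms by (simp add: group_with_identity_def)
  show "e * e = e" using r_one[of e] one_closed by simp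
  show "G \<subseteq> local_units e"
  proof
    fix x assume x: "x \<in> G"
    let ?y = "inv\<^bsub>\<lparr>carrier = G, monoid.mult = (*), one = e\<rparr>\<^esub> x"
    have y: "?y \<in> G" "x * ?y = e" "?y * x = e"
      using inv_closed[of x] r_inv[of x] l_inv[of x] x by simp_all
    then show "x \<in> local_units e"
      using x l_one[of x] r_one[of x] l_one[of ?y] r_one[of ?y] unfolding local_units_def by auto
  qed
qed

lemma green_L_iff: "green_L x y \<longleftrightarrow> x = y \<or> (\<exists>p q. x = p * y \<and> y = q * x)"
proof
  assume "green_L x y"
  then have "x \<in> insert y (range (\<lambda>z. z * y))" "y \<in> insert x (range (\<lambda>z. z * x))"
    unfolding green_L_def by blast+
  then show "x = y \<or> (\<exists>p q. x = p * y \<and> y = q * x)" by auto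
next
  assume "x = y \<or> (\<exists>p q. x = p * y \<and> y = q * x)"
  then show "green_L x y"
  proof
    assume "\<exists>p q. x = p * y \<and> y = q * x"
    then obtain p q where x: "x = p * y" and y: "y = q * x" by blast
    have "z * x = (z * p) * y" "z * y = (z * q) * x" for z
      using x y by (metis mult.assoc)+
    then have "range (\<lambda>z. z * x) = range (\<lambda>z. z * y)" by (auto simp: image_iff; metis)
    then show ?thesis unfolding green_L_def using x y by (metis insert_absorb rangeI)
  qed (simp add: green_L_def)
qed

lemma green_R_iff: "green_R x y \<longleftrightarrow> x = y \<or> (\<exists>p q. x = y * p \<and> y = x * q)"
proof
  assume "green_R x y"
  then have "x \<in> insert y (range (\<lambda>z. y * z))" "y \<in> insert x (range (\<lambda>z. x * z))"
    unfolding green_R_def by blast+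
  then show "x = y \<or> (\<exists>p q. x = y * p \<and> y = x * q)" by auto
next
  assume "x = y \<or> (\<exists>p q. x = y * p \<and> y = x * q)"
  then show "green_R x y"
  proof
    assume "\<exists>p q. x = y * p \<and> y = x * q"
    then obtain p q where x: "x = y * p" and y: "y = x * q" by blast
    have "x * z = y * (p * z)" "y * z = x * (q * z)" for z
      using x y by (metis mult.assoc)+
    then have "range (\<lambda>z. x * z) = range (\<lambda>z. y * z)" by (auto simp: image_iff; metis)
    then show ?thesis unfolding green_R_def using x y by (metis insert_absorb rangeI)
  qed (simp add: green_R_def)
qed

text \<open>This is the part of Green's theorem that makes \<open>epi_idem\<close> meaningful: an
  \<open>\<H>\<close>-class that meets a subgroup with identity \<open>e\<close> is a group with the same identity.
  An element of the class is divisible by \<open>e\<close> on both sides and divides it on both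
  sides; cutting the quotients down to \<open>e S e\<close> makes them agree.\<close>

lemma H_class_eq_local_units:
  assumes x: "x \<in> local_units e" and e: "e * e = e"
  shows "H_class x = local_units e"
proof -
  obtain w where w: "e * x = x" "x * e = x" "x * w = e" "w * x = e"
    using x unfolding local_units_def by blast
  have "green_L x e" "green_R x e"
    unfolding green_L_iff green_R_iff using w by metis+
  then have "green_H x y \<longleftrightarrow> green_H e y" for y
    unfolding green_H_def green_L_def green_R_def by simp
  moreover have "green_H e y \<longleftrightarrow> y \<in> local_units e" for y
  proof
    assume "green_H e y"
    then have L: "e = y \<or> (\<exists>p q. e = p * y \<and> y = q * e)"
      and R: "e = y \<or> (\<exists>p q. e = y * p \<and> y = e * q)"
      unfolding green_H_def green_L_iff green_R_iff by blast+
    show "y \<in> local_units e"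
    proof (cases "e = y")
      case True
      then show ?thesis using e by (auto simp: local_units_def)
    next
      case False
      then obtain p q p' q' where p: "e = p * y" "y = q * e" "e = y * p'" "y = e * q'"
        using L R by blast
      have y: "e * y = y" "y * e = y" using p e by (metis mult.assoc)+
      have l: "(e * p * e) * y = e" using p(1) y e by (metis mult.assoc)
      have r: "y * (e * p' * e) = e" using p(3) y e by (metis mult.assoc)
      have "e * p * e = (e * p * e) * (y * (e * p' * e))" using r e by (metis mult.assoc)
      also have "\<dots> = e * p' * e" using l e by (metis mult.assoc)
      finally have eq: "e * p * e = e * p' * e" .
      have "e * (e * p * e) = e * p * e" "(e * p * e) * e = e * p * e"
        using e by (metis mult.assoc)+
      then show ?thesis using y l r eq unfolding local_units_def by auto
    qed
  next
    assume "y \<in> local_units e"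
    then obtain z where "e * y = y" "y * e = y" "y * z = e" "z * y = e"
      unfolding local_units_def by blast
    then show "green_H e y"
      unfolding green_H_def green_L_iff green_R_iff by metis
  qed
  ultimately show ?thesis unfolding H_class_def by blast
qed

section \<open>Drazin inverses and the idempotent of a group-bound element\<close>

text \<open>The exponent is \<open>Suc n\<close> because only positive powers exist in a semigroup; thus \<open>n = 0\<close> says
  that \<open>a\<close> itself is a group element.\<close>

definition drazin_inverse :: "nat \<Rightarrow> 'a::semigroup_mult \<Rightarrow> 'a \<Rightarrow> bool" where
  "drazin_inverse n a c \<longleftrightarrow> a * c = c * a \<and> c * a * c = c \<and>
     sg_power a (Suc n) * (a * c) = sg_power a (Suc n)"

lemma drazin_inverseD:
  assumes "drazin_inverse n a c"
  shows "a * c = c * a" "c * a * c = c" "sg_power a (Suc n) * (a * c) = sg_power a (Suc n)"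
  using assms unfolding drazin_inverse_def by blast+

text \<open>The quotient is \<open>c ^ (k + 1)\<close> on either side. As \<open>k\<close> is arbitrary, an element that fixes
  some power of \<open>a\<close> by multiplication also fixes \<open>a c\<close>, whence the uniqueness below.\<close>

lemma drazin_idempotent_divisible:
  assumes "drazin_inverse n a c"
  shows "\<exists>z. sg_power a (Suc k) * z = a * c" and "\<exists>z. z * sg_power a (Suc k) = a * c"
proof -
  note c = drazin_inverseD[OF assms]
  show "\<exists>z. sg_power a (Suc k) * z = a * c"
  proof (induction k)
    case (Suc k)
    then obtain z where z: "sg_power a (Suc k) * z = a * c" by blast
    have "sg_power a (Suc (Suc k)) * (z * c) = a * (sg_power a (Suc k) * z) * c"
      by (metis sg_power_Suc_Suc sg_power_commute mult.assoc)
    also have "\<dots> = a * c" using z c by (metis mult.assoc)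
    finally show ?case by blast
  qed auto
  show "\<exists>z. z * sg_power a (Suc k) = a * c"
  proof (induction k)
    case 0
    show ?case using c(1) by auto
  next
    case (Suc k)
    then obtain z where z: "z * sg_power a (Suc k) = a * c" by blast
    have "(c * z) * sg_power a (Suc (Suc k)) = c * (z * sg_power a (Suc k)) * a"
      by (metis sg_power_Suc_Suc mult.assoc)
    also have "\<dots> = a * c" using z c by (metis mult.assoc)
    finally show ?case by blast
  qed
qed

lemma drazin_idempotent_unique:
  assumes c: "drazin_inverse n a c" and d: "drazin_inverse m a d"
  shows "a * c = a * d"
proof -
  obtain z where z: "z * sg_power a (Suc m) = a * c"
    using drazin_idempotent_divisible(2)[OF c] by blast
  obtain z' where z': "sg_power a (Suc n) * z' = a * d"
    using drazin_idempotent_divisible(1)[OF d] by blast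
  have "(a * c) * a = a * (a * c)" using drazin_inverseD(1)[OF c] by (metis mult.assoc)
  then have "(a * c) * sg_power a (Suc n) = sg_power a (Suc n)"
    using sg_power_commute[of "a * c" a n] drazin_inverseD(3)[OF c] by simp
  then have "(a * c) * (a * d) = a * d" using z' by (metis mult.assoc)
  moreover have "(a * c) * (a * d) = a * c"
    using z drazin_inverseD(3)[OF d] by (metis mult.assoc)
  ultimately show ?thesis by simp
qed

text \<open>If \<open>w\<close> is the inverse of \<open>a ^ t\<close> in a subgroup, the Drazin inverse of \<open>a\<close> is
  \<open>a ^ (t - 1) w\<close>, or just \<open>w\<close> when \<open>t = 1\<close>. The point is that \<open>w\<close> commutes with \<open>a\<close>, and the
  identity \<open>e\<close> has to be moved across \<open>a\<close> before \<open>w\<close> can be.\<close>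

lemma drazin_inverse_of_local_unit:
  assumes u: "sg_power a (Suc n) \<in> local_units e"
  shows "\<exists>c. drazin_inverse n a c \<and> e = a * c"
proof -
  define p where "p = sg_power a (Suc n)"
  obtain w where w: "e * p = p" "p * e = p" "e * w = w" "w * e = w" "p * w = e" "w * p = e"
    using u unfolding local_units_def p_def by blast
  have ap: "a * p = p * a" unfolding p_def by (rule sg_power_commute) simp
  have ea: "e * a = a * e"
  proof -
    have "e * a = w * (a * p)" using w ap by (metis mult.assoc)
    also have "\<dots> = w * (a * p) * e" using w by (metis mult.assoc)
    also have "\<dots> = e * a * e" using w ap by (metis mult.assoc)
    finally have 1: "e * a = e * a * e" .
    have "a * e = (p * a) * w" using w ap by (metis mult.assoc)
    also have "\<dots> = e * (p * a) * w" using w by (metis mult.assoc)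
    also have "\<dots> = e * a * e" using w ap by (metis mult.assoc)
    finally show ?thesis using 1 by simp
  qed
  have wa: "w * a = a * w"
  proof -
    have "w * a = w * (a * p) * w" using w ea by (metis mult.assoc)
    also have "\<dots> = e * a * w" using w ap by (metis mult.assoc)
    also have "\<dots> = a * w" using w ea by (metis mult.assoc)
    finally show ?thesis .
  qed
  have "\<exists>c. a * c = e \<and> c * a = e \<and> c * e = c"
  proof (cases n)
    case 0
    then have "p = a" by (simp add: p_def)
    then show ?thesis using w by blast
  next
    case (Suc m)
    define q where "q = sg_power a (Suc m)"
    have p: "p = q * a" "p = a * q"
      unfolding p_def q_def Suc by (metis sg_power_Suc_Suc sg_power_commute)+
    have "a * (q * w) = e" "(q * w) * a = e" "(q * w) * e = q * w"
      using p w wa by (metis mult.assoc)+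
    then show ?thesis by blast
  qed
  then obtain c where c: "a * c = e" "c * a = e" "c * e = c" by blast
  have "c * a * c = c" using c by (metis mult.assoc)
  then have "drazin_inverse n a c"
    unfolding drazin_inverse_def using c w(2) by (simp add: p_def)
  then show ?thesis using c by blast
qed

lemma epi_idem_drazin:
  assumes "group_bound a"
  shows "\<exists>n c. drazin_inverse n a c \<and> epi_idem a = a * c"
proof -
  let ?P = "\<lambda>e. \<exists>t\<ge>1. group_with_identity (H_class (sg_power a t)) e"
  have drazin: "\<exists>n c. drazin_inverse n a c \<and> e = a * c" if "?P e" for e
  proof -
    obtain t where t: "t \<ge> 1" "group_with_identity (H_class (sg_power a t)) e"
      using \<open>?P e\<close> by blast
    have "sg_power a t \<in> H_class (sg_power a t)"
      by (simp add: H_class_def green_H_def green_L_def green_R_def)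
    then have "sg_power a (Suc (t - 1)) \<in> local_units e"
      using t group_with_identity_subset_local_units(1) by auto
    then show ?thesis using drazin_inverse_of_local_unit by blast
  qed
  obtain t G e where t: "t \<ge> 1" "group_with_identity G e" "sg_power a t \<in> G"
    using assms unfolding group_bound_def group_element_def by blast
  note G = group_with_identity_subset_local_units[OF t(2)]
  have "H_class (sg_power a t) = local_units e"
    using H_class_eq_local_units t(3) G by blast
  then have ex: "?P e" using group_local_units[OF G(2)] t(1) by auto
  have "?P (epi_idem a)"
    unfolding epi_idem_def
  proof (rule theI)
    show "?P e" by (rule ex)
    show "f = e" if "?P f" for f
      using drazin[OF that] drazin[OF ex] drazin_idempotent_unique by metis
  qed
  then show ?thesis by (rule drazin)
qed

lemma epi_idem_eq:
  assumes "group_bound a" "drazin_inverse n a c"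
  shows "epi_idem a = a * c"
proof -
  obtain m d where d: "drazin_inverse m a d" "epi_idem a = a * d"
    using epi_idem_drazin[OF assms(1)] by blast
  then show ?thesis using drazin_idempotent_unique[OF d(1) assms(2)] by simp
qed

section \<open>Behaviour under primary conjugation\<close>

lemma sg_power_swap: "sg_power (y * x) (Suc (Suc n)) = y * sg_power (x * y) (Suc n) * x"
proof (induction n)
  case 0
  show ?case by (simp add: sg_power_Suc_Suc mult.assoc)
next
  case (Suc n)
  have "sg_power (y * x) (Suc (Suc (Suc n))) = y * sg_power (x * y) (Suc n) * x * (y * x)"
    using Suc by (simp only: sg_power_Suc_Suc[of _ "Suc n"])
  also have "\<dots> = y * sg_power (x * y) (Suc (Suc n)) * x"
    by (simp add: sg_power_Suc_Suc mult.assoc)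
  finally show ?case .
qed

text \<open>A rewrite system for right-associated words in \<open>x\<close>, \<open>y\<close> and \<open>c\<close>, where \<open>c\<close> is a
  Drazin inverse of \<open>x y\<close>: the letter \<open>c\<close> moves to the right across \<open>x y\<close>, and \<open>x y c c\<close>
  contracts to \<open>c\<close>.\<close>

lemma drazin_rewrites:
  assumes "drazin_inverse n (x * y) c"
  shows "c * (x * y) = x * (y * c)" "c * (x * (y * z)) = x * (y * (c * z))"
    "x * (y * (c * c)) = c" "x * (y * (c * (c * z))) = c * z"
proof -
  note c = drazin_inverseD[OF assms]
  show 1: "c * (x * y) = x * (y * c)" using c(1) by (simp add: mult.assoc)
  then show "c * (x * (y * z)) = x * (y * (c * z))" by (metis mult.assoc)
  show 2: "x * (y * (c * c)) = c" using c(1,2) by (metis mult.assoc)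
  then show "x * (y * (c * (c * z))) = c * z" by (metis mult.assoc)
qed

text \<open>Cline's formula. The index may grow by one, in accordance with
  \<open>(y x) ^ (k + 1) = y (x y) ^ k x\<close>.\<close>

lemma cline:
  assumes "drazin_inverse n (x * y) c"
  shows "drazin_inverse (Suc n) (y * x) (y * c * c * x)"
    and "(y * x) * (y * c * c * x) = y * c * x"
proof -
  note rw = drazin_rewrites[OF assms]
  show bd: "(y * x) * (y * c * c * x) = y * c * x" by (simp add: mult.assoc rw)
  have db: "(y * c * c * x) * (y * x) = y * c * x" by (simp add: mult.assoc rw)
  have dbd: "(y * c * x) * (y * c * c * x) = y * c * c * x" by (simp add: mult.assoc rw)
  have "(y * sg_power (x * y) (Suc n) * x) * (y * c * x)
      = y * (sg_power (x * y) (Suc n) * ((x * y) * c)) * x"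
    by (simp only: mult.assoc)
  also have "\<dots> = y * sg_power (x * y) (Suc n) * x"
    by (simp only: drazin_inverseD(3)[OF assms])
  finally have "sg_power (y * x) (Suc (Suc n)) * (y * c * x) = sg_power (y * x) (Suc (Suc n))"
    unfolding sg_power_swap .
  then show "drazin_inverse (Suc n) (y * x) (y * c * c * x)"
    unfolding drazin_inverse_def by (simp only: bd db dbd simp_thms)
qed

text \<open>Strengthens the condition of the theorem by requiring \<open>u v\<close> and \<open>v u\<close> to be the
  given idempotents; without this, composing two such pairs need not give mutually
  inverse elements.\<close>

definition linked :: "'a::semigroup_mult \<Rightarrow> 'a \<Rightarrow> 'a \<Rightarrow> 'a \<Rightarrow> bool" where
  "linked e p f q \<longleftrightarrow> (\<exists>u v. mutually_inverse u v \<and> u * v = e \<and> v * u = f \<and>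
     p = u * q * v \<and> q = v * p * u)"

lemma linked_trans:
  assumes "linked e p f q" "linked f q g r"
  shows "linked e p g r"
proof -
  obtain u v where u: "u = u * v * u" "v = v * u * v" "u * v = e" "v * u = f"
      "p = u * q * v" "q = v * p * u"
    using assms(1) unfolding linked_def mutually_inverse_def by blast
  obtain s t where s: "s = s * t * s" "t = t * s * t" "s * t = f" "t * s = g"
      "q = s * r * t" "r = t * q * s"
    using assms(2) unfolding linked_def mutually_inverse_def by blast
  have e: "(u * s) * (t * v) = e" using u s by (metis mult.assoc)
  have g: "(t * v) * (u * s) = g" using u s by (metis mult.assoc)
  have "u * s = (u * s) * (t * v) * (u * s)" unfolding e using u by (metis mult.assoc)
  moreover have "t * v = (t * v) * (u * s) * (t * v)" unfolding g using s by (metis mult.assoc)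
  moreover have "p = (u * s) * r * (t * v)" using u(5) s(5) by (simp add: mult.assoc)
  moreover have "r = (t * v) * p * (u * s)" using u(6) s(6) by (simp add: mult.assoc)
  ultimately show ?thesis using e g unfolding linked_def mutually_inverse_def by blast
qed

lemma linked_swap:
  assumes "drazin_inverse n (x * y) c"
  shows "linked (x * y * c) ((x * y) * (x * y * c)) (y * c * x) ((y * x) * (y * c * x))"
proof -
  note rw = drazin_rewrites[OF assms]
  let ?u = "x * y * c * x" and ?v = "y * c"
  have "mutually_inverse ?u ?v" unfolding mutually_inverse_def by (simp add: mult.assoc rw)
  moreover have "?u * ?v = x * y * c" "?v * ?u = y * c * x" by (simp_all add: mult.assoc rw)
  moreover have "(x * y) * (x * y * c) = ?u * ((y * x) * (y * c * x)) * ?v"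
    "(y * x) * (y * c * x) = ?v * ((x * y) * (x * y * c)) * ?u"
    by (simp_all add: mult.assoc rw)
  ultimately show ?thesis unfolding linked_def by blast
qed

text \<open>With \<open>x = u\<close> and \<open>y = v p\<close>, the product \<open>x y = u v p\<close> is \<open>p\<close> because \<open>u v\<close> is an idempotent
  fixing \<open>p = u q v\<close> on the left.\<close>

lemma mutually_inverse_imp_primarily_conjugate:
  assumes "mutually_inverse u v" "p = u * q * v" "q = v * p * u"
  shows "primarily_conjugate p q"
proof -
  have "u * (v * p) = (u * v * u) * q * v" using assms(2) by (simp add: mult.assoc)
  then have "p = u * (v * p)" using assms(1,2) by (metis mutually_inverse_def)
  then show ?thesis using assms(3) unfolding primarily_conjugate_def by blast
qed

lemma linked_imp_primarily_conjugate: "linked e p f q \<Longrightarrow> primarily_conjugate p q"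
  unfolding linked_def using mutually_inverse_imp_primarily_conjugate by blast

section \<open>Conjugacy in regular semigroups\<close>

lemma primarily_conjugate_sym: "primarily_conjugate a b \<Longrightarrow> primarily_conjugate b a"
  unfolding primarily_conjugate_def by blast

lemma conjugate_sym: "conjugate a b \<Longrightarrow> conjugate b a"
  unfolding conjugate_def
proof (induction rule: tranclp_induct)
  case (base c)
  then show ?case using primarily_conjugate_sym by blast
next
  case (step b c)
  then show ?case using primarily_conjugate_sym tranclp_into_tranclp2 by metis
qed

lemma conjugate_trans: "conjugate a b \<Longrightarrow> conjugate b c \<Longrightarrow> conjugate a c"
  unfolding conjugate_def by (rule tranclp_trans)

lemma primarily_conjugate_imp_conjugate: "primarily_conjugate a b \<Longrightarrow> conjugate a b"
  unfolding conjugate_def by (rule tranclp.r_into_trancl)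

text \<open>For \<open>b = a a a'\<close> one has \<open>b ^ k = a ^ (k + 1) a'\<close>, and \<open>b\<close> times its Drazin inverse is
  \<open>a c a a'\<close>, so in \<open>b ^ k (a c a a')\<close> the inner \<open>a a' a\<close> collapses to \<open>a\<close>. Thus the index drops by one,
  whereas Cline's formula by itself would let it rise.\<close>

lemma drazin_inverse_index_drop:
  assumes c: "drazin_inverse (Suc n) a c" and a: "a = a * a' * a"
  shows "drazin_inverse n (a * (a * a')) (a * c * c * (a * a'))"
proof -
  note cD = drazin_inverseD[OF c]
  have c': "drazin_inverse (Suc n) ((a * a') * a) c" using c a by simp
  note d = drazin_inverseD[OF cline(1)[OF c']]
  have pow: "sg_power (a * (a * a')) (Suc k) = sg_power a (Suc (Suc k)) * a'" for k
  proof (induction k)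
    case 0
    show ?case by (simp add: sg_power_Suc_Suc mult.assoc)
  next
    case (Suc k)
    have "sg_power (a * (a * a')) (Suc (Suc k))
        = sg_power a (Suc k) * (a * a' * a) * (a * a')"
      using Suc by (simp only: sg_power_Suc_Suc[of _ k] sg_power_Suc_Suc[of _ "Suc k"] mult.assoc)
    also have "\<dots> = sg_power a (Suc (Suc (Suc k))) * a'"
      using a by (simp add: sg_power_Suc_Suc mult.assoc)
    finally show ?case .
  qed
  have "sg_power (a * (a * a')) (Suc n) * (a * c * (a * a'))
      = sg_power a (Suc n) * (a * a' * a) * c * a * a'"
    unfolding pow by (simp only: sg_power_Suc_Suc[of _ n] mult.assoc)
  also have "\<dots> = sg_power a (Suc (Suc n)) * (a * c) * a'"
    using a cD(1) by (metis sg_power_Suc_Suc mult.assoc)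
  also have "\<dots> = sg_power (a * (a * a')) (Suc n)"
    unfolding pow by (simp only: cD(3))
  finally show ?thesis
    unfolding drazin_inverse_def using d(1,2) by (simp only: cline(2)[OF c'] simp_thms)
qed

lemma conjugate_group_part:
  assumes regular: "\<forall>s::'a::semigroup_mult. regular_element s"
    and "drazin_inverse n (a::'a) c"
  shows "conjugate a (a * (a * c))"
  using assms(2)
proof (induction n arbitrary: a c)
  case (0 a c)
  obtain a' where a: "a = a * a' * a"
    using regular unfolding regular_element_def by blast
  then have "primarily_conjugate a (a * (a * a'))"
    unfolding primarily_conjugate_def by blast
  (* Conjugacy is only a transitive closure, so its reflexivity at a has to come from
     a step away from a and back. *)
  then have "conjugate a a"
    using conjugate_sym conjugate_trans primarily_conjugate_imp_conjugate by blast
  moreover have "a * (a * c) = a" using drazin_inverseD(3)[OF 0] by simp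
  ultimately show ?case by simp
next
  case (Suc n a c)
  obtain a' where a: "a = a * a' * a"
    using regular unfolding regular_element_def by blast
  let ?b = "a * (a * a')" and ?d = "a * c * c * (a * a')"
  have c': "drazin_inverse (Suc n) ((a * a') * a) c" using Suc.prems a by simp
  have "conjugate a ?b"
    using a primarily_conjugate_imp_conjugate unfolding primarily_conjugate_def by blast
  moreover have "conjugate ?b (?b * (?b * ?d))"
    using Suc.IH drazin_inverse_index_drop[OF Suc.prems a] .
  moreover have "conjugate (?b * (?b * ?d)) (a * (a * c))"
    using linked_swap[OF c'] a unfolding cline(2)[OF c']
    by (metis linked_imp_primarily_conjugate primarily_conjugate_sym
        primarily_conjugate_imp_conjugate)
  ultimately show ?case using conjugate_trans by blast
qed

theorem theorem2:
  fixes a b :: "'a::semigroup_mult"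
  assumes regular: "\<forall>s::'a. regular_element s"
    and epigroup: "\<forall>s::'a. group_bound s"
  shows "conjugate a b \<longleftrightarrow>
    (\<exists>u v. mutually_inverse u v \<and>
       a * epi_idem a = u * (b * epi_idem b) * v \<and>
       b * epi_idem b = v * (a * epi_idem a) * u)"
proof
  have linked_step: "linked (epi_idem s) (s * epi_idem s) (epi_idem t) (t * epi_idem t)"
    if "primarily_conjugate s t" for s t :: 'a
  proof -
    obtain x y where xy: "s = x * y" "t = y * x"
      using \<open>primarily_conjugate s t\<close> unfolding primarily_conjugate_def by blast
    obtain n c where c: "drazin_inverse n (x * y) c" "epi_idem s = x * y * c"
      using epi_idem_drazin epigroup xy(1) by blast
    have "epi_idem t = y * c * x"
      using epi_idem_eq[OF _ cline(1)[OF c(1)]] cline(2)[OF c(1)] epigroup xy(2) by simp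
    then show ?thesis using linked_swap[OF c(1)] c(2) xy by simp
  qed
  assume "conjugate a b"
  then have "linked (epi_idem a) (a * epi_idem a) (epi_idem b) (b * epi_idem b)"
    unfolding conjugate_def
  proof (induction rule: tranclp_induct)
    case (base t)
    then show ?case by (rule linked_step)
  next
    case (step s t)
    then show ?case using linked_trans linked_step by blast
  qed
  then show "\<exists>u v. mutually_inverse u v \<and>
       a * epi_idem a = u * (b * epi_idem b) * v \<and>
       b * epi_idem b = v * (a * epi_idem a) * u"
    unfolding linked_def by blast
next
  assume "\<exists>u v. mutually_inverse u v \<and>
       a * epi_idem a = u * (b * epi_idem b) * v \<and>
       b * epi_idem b = v * (a * epi_idem a) * u"
  then have "primarily_conjugate (a * epi_idem a) (b * epi_idem b)"
    using mutually_inverse_imp_primarily_conjugate by blast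
  moreover have "conjugate s (s * epi_idem s)" for s :: 'a
    using epi_idem_drazin[of s] epigroup conjugate_group_part[OF regular, of _ s] by auto
  ultimately show "conjugate a b"
    using conjugate_sym conjugate_trans primarily_conjugate_imp_conjugate by metis
qed

end
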